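(* Let $w \in F_k$ be a group word and let $G$ be a profinite group. Suppose that $G = AB$, where $A \unlhd G$ and $B \le G$ are abelian profinite (i.e. closed abelian) subgroups of $G$, and that $|w\{G\}| < 2^{\aleph_0}$. Then $w\{G\}$ is finite.
   Context: A group word $w$ in $k$ variables is an element of the free group $F_k$ of rank $k$; substituting elements of a group $G$ for the variables defines the word map $w\colon G^k\to G$. The set of $w$-values is $w\{G\}=\{w(g_1,\dots,g_k)\mid g_i\in G\}$. *)

theory Defs
  imports "HOL-Analysis.Analysis" "HOL-Algebra.Coset" "HOL-Library.Equipollence"
begin

section \<open>The free group of rank \<open>k\<close> and word maps\<close>

text \<open>
  The letter \<open>(i, False)\<close> stands for the generator \<open>x\<^sub>i\<close> and \<open>(i, True)\<close> for its inverse.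
  Elements of the free group are represented by reduced words, one for each element.
\<close>

type_synonym letter = "nat \<times> bool"

fun inv_letter :: "letter \<Rightarrow> letter" where
  "inv_letter (i, b) = (i, \<not> b)"

definition reduced :: "letter list \<Rightarrow> bool" where
  "reduced w \<longleftrightarrow> successively (\<lambda>x y. y \<noteq> inv_letter x) w"

fun reduced_Cons :: "letter \<Rightarrow> letter list \<Rightarrow> letter list" where
  "reduced_Cons x [] = [x]"
| "reduced_Cons x (y # w) = (if y = inv_letter x then w else x # y # w)"

definition free_group :: "nat \<Rightarrow> letter list monoid" where
  "free_group k =
     \<lparr>carrier = {w. reduced w \<and> (\<forall>x\<in>set w. fst x < k)},
      mult = (\<lambda>u v. foldr reduced_Cons u v),
      one = []\<rparr>"

fun letter_value :: "('a, 'm) monoid_scheme \<Rightarrow> (nat \<Rightarrow> 'a) \<Rightarrow> letter \<Rightarrow> 'a" where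
  "letter_value G g (i, b) = (if b then inv\<^bsub>G\<^esub> (g i) else g i)"

definition word_map :: "('a, 'm) monoid_scheme \<Rightarrow> letter list \<Rightarrow> (nat \<Rightarrow> 'a) \<Rightarrow> 'a" where
  "word_map G w g = foldr (\<lambda>x a. letter_value G g x \<otimes>\<^bsub>G\<^esub> a) w \<one>\<^bsub>G\<^esub>"

definition word_values :: "('a, 'm) monoid_scheme \<Rightarrow> nat \<Rightarrow> letter list \<Rightarrow> 'a set" where
  "word_values G k w = word_map G w ` ({..<k} \<rightarrow>\<^sub>E carrier G)"

section \<open>Profinite groups\<close>

locale topological_group = group G for G (structure) +
  fixes X :: "'a topology"
  assumes topspace_eq_carrier: "topspace X = carrier G"
    and continuous_mult: "continuous_map (prod_topology X X) X (\<lambda>(x, y). x \<otimes> y)"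
    and continuous_inv: "continuous_map X X (\<lambda>x. inv x)"

locale profinite_group = topological_group +
  assumes compact: "compact_space X"
    and Hausdorff: "Hausdorff_space X"
    and totally_disconnected: "\<And>x. x \<in> topspace X \<Longrightarrow> connected_component_of_set X x = {x}"

section \<open>Sanity checks for the free group\<close>

lemma inv_letter_inv_letter [simp]: "inv_letter (inv_letter x) = x"
  by (cases x) auto

lemma inv_letter_neq [simp]: "inv_letter x \<noteq> x" "x \<noteq> inv_letter x"
  by (cases x; auto)+

lemma fst_inv_letter [simp]: "fst (inv_letter x) = fst x"
  by (cases x) auto

lemma reduced_Nil [simp]: "reduced []"
  by (simp add: reduced_def)

lemma reduced_Cons_iff: "reduced (x # w) \<longleftrightarrow> reduced w \<and> (w = [] \<or> hd w \<noteq> inv_letter x)"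
  by (cases w) (auto simp: reduced_def)

lemma reduced_reduced_Cons: "reduced w \<Longrightarrow> reduced (reduced_Cons x w)"
  by (cases w) (auto simp: reduced_Cons_iff)

lemma reduced_foldr: "reduced v \<Longrightarrow> reduced (foldr reduced_Cons u v)"
  by (induction u) (auto simp: reduced_reduced_Cons)

lemma set_reduced_Cons: "set (reduced_Cons x w) \<subseteq> insert x (set w)"
  by (cases w) auto

lemma set_foldr_reduced_Cons: "set (foldr reduced_Cons u v) \<subseteq> set u \<union> set v"
proof (induction u)
  case (Cons x u)
  then show ?case using set_reduced_Cons[of x "foldr reduced_Cons u v"] by auto
qed auto

lemma reduced_Cons_cancel:
  assumes "reduced w"
  shows "reduced_Cons (inv_letter x) (reduced_Cons x w) = w"
proof (cases w)
  case (Cons y v)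
  then show ?thesis using assms by (cases v) (auto simp: reduced_Cons_iff)
qed auto

lemma foldr_reduced_Cons_step:
  assumes "reduced v"
  shows "foldr reduced_Cons (reduced_Cons x u) v = reduced_Cons x (foldr reduced_Cons u v)"
proof (cases u)
  case (Cons y u')
  then show ?thesis
    using reduced_Cons_cancel[OF reduced_foldr[OF assms, of u'], of "inv_letter x"] by auto
qed auto

lemma foldr_reduced_Cons_assoc:
  assumes "reduced w"
  shows "foldr reduced_Cons (foldr reduced_Cons u v) w = foldr reduced_Cons u (foldr reduced_Cons v w)"
  using assms by (induction u) (auto simp: foldr_reduced_Cons_step)

lemma foldr_reduced_Cons_Nil: "reduced u \<Longrightarrow> foldr reduced_Cons u [] = u"
proof (induction u)
  case (Cons x u)
  then show ?case by (cases u) (auto simp: reduced_Cons_iff)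
qed auto

lemma foldr_reduced_Cons_inverse:
  assumes "reduced v"
  shows "foldr reduced_Cons (map inv_letter (rev u)) (foldr reduced_Cons u v) = v"
  using assms by (induction u arbitrary: v) (auto simp: reduced_Cons_cancel reduced_foldr)

lemma reduced_inverse_word: "reduced u \<Longrightarrow> reduced (map inv_letter (rev u))"
  unfolding reduced_def successively_map successively_rev
  by (erule successively_mono) (metis inv_letter_inv_letter)

theorem group_free_group: "group (free_group k)"
proof (rule groupI)
  fix u assume u: "u \<in> carrier (free_group k)"
  let ?v = "map inv_letter (rev u)"
  have "?v \<in> carrier (free_group k)"
    using u by (auto simp: free_group_def reduced_inverse_word)
  moreover have "foldr reduced_Cons ?v u = []"
    using u foldr_reduced_Cons_inverse[of "[]" u] by (simp add: free_group_def foldr_reduced_Cons_Nil)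
  ultimately show "\<exists>v\<in>carrier (free_group k). v \<otimes>\<^bsub>free_group k\<^esub> u = \<one>\<^bsub>free_group k\<^esub>"
    by (intro bexI[of _ ?v]) (simp_all add: free_group_def)
next
  fix u v assume "u \<in> carrier (free_group k)" "v \<in> carrier (free_group k)"
  then show "u \<otimes>\<^bsub>free_group k\<^esub> v \<in> carrier (free_group k)"
    using set_foldr_reduced_Cons[of u v] by (auto simp: free_group_def reduced_foldr)
qed (auto simp: free_group_def foldr_reduced_Cons_assoc)

context group
begin

lemma letter_value_closed:
  "g (fst x) \<in> carrier G \<Longrightarrow> letter_value G g x \<in> carrier G"
  by (cases x) auto

lemma word_map_closed:
  "(\<And>x. x \<in> set w \<Longrightarrow> g (fst x) \<in> carrier G) \<Longrightarrow> word_map G w g \<in> carrier G"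
  by (induction w) (auto simp: word_map_def letter_value_closed)

lemma letter_value_inv_letter:
  assumes "g (fst x) \<in> carrier G" "a \<in> carrier G"
  shows "letter_value G g x \<otimes> (letter_value G g (inv_letter x) \<otimes> a) = a"
  using assms by (cases x) (auto simp: m_assoc[symmetric])

lemma word_map_reduced_Cons:
  assumes "g (fst x) \<in> carrier G" "\<And>y. y \<in> set w \<Longrightarrow> g (fst y) \<in> carrier G"
  shows "word_map G (reduced_Cons x w) g = letter_value G g x \<otimes> word_map G w g"
proof (cases w)
  case (Cons y v)
  have "word_map G v g \<in> carrier G"
    using assms Cons by (intro word_map_closed) auto
  then show ?thesis
    using assms(1) Cons letter_value_inv_letter[of g x "word_map G v g"]
    by (auto simp: word_map_def)
qed (auto simp: word_map_def)

text \<open>Evaluation at \<open>g\<close> is the homomorphism extending \<open>x\<^sub>i \<mapsto> g i\<close>.\<close>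

theorem word_map_hom:
  assumes g: "g \<in> {..<k} \<rightarrow> carrier G"
  shows "(\<lambda>w. word_map G w g) \<in> hom (free_group k) G"
    and "i < k \<Longrightarrow> word_map G [(i, False)] g = g i"
proof -
  have mult: "word_map G (foldr reduced_Cons u v) g = word_map G u g \<otimes> word_map G v g"
    if "\<forall>x\<in>set u. fst x < k" "\<forall>x\<in>set v. fst x < k" for u v
    using that(1)
  proof (induction u)
    case Nil
    have "word_map G v g \<in> carrier G"
      using that(2) g by (intro word_map_closed) auto
    then show ?case by (simp add: word_map_def)
  next
    case (Cons x u)
    have car: "word_map G u g \<in> carrier G" "word_map G v g \<in> carrier G"
      using Cons.prems that(2) g by (auto intro!: word_map_closed)
    have x: "g (fst x) \<in> carrier G"
      using Cons.prems g by auto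
    have fst_lt: "fst y < k" if "y \<in> set (foldr reduced_Cons u v)" for y
      using that set_foldr_reduced_Cons[of u v] Cons.prems \<open>\<forall>x\<in>set v. fst x < k\<close> by auto
    have "word_map G (foldr reduced_Cons (x # u) v) g
        = letter_value G g x \<otimes> word_map G (foldr reduced_Cons u v) g"
      using x g fst_lt by (simp add: word_map_reduced_Cons Pi_iff)
    also have "\<dots> = letter_value G g x \<otimes> (word_map G u g \<otimes> word_map G v g)"
      using Cons by simp
    also have "\<dots> = word_map G (x # u) g \<otimes> word_map G v g"
      using car letter_value_closed[of g x] x by (simp add: word_map_def m_assoc)
    finally show ?case .
  qed
  show "(\<lambda>w. word_map G w g) \<in> hom (free_group k) G"
    using g mult by (auto simp: hom_def free_group_def intro!: word_map_closed)
  show "word_map G [(i, False)] g = g i" if "i < k"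
    using funcset_mem[OF g, of i] that by (simp add: word_map_def)
qed

end

end

theory Submission
  imports Defs "HOL-Algebra.Product_Groups"
begin

text \<open>
Write each argument of \<open>w\<close> as \<open>m\<^sub>i b\<^sub>i\<close> with \<open>m\<^sub>i \<in> A\<close> and \<open>b\<^sub>i \<in> B\<close>, and move the factors from \<open>A\<close> to the
left. This gives \<open>w(m b) = F(b)(m) w(b)\<close>, where \<open>F(b)(m)\<close> is a product over the letters of \<open>w\<close>: the
letter at position \<open>j\<close>, evaluated at \<open>m\<close>, is conjugated by an element \<open>\<phi>\<^sub>j(b)\<close> of \<open>B\<close>. Since \<open>B\<close> is
abelian, each \<open>\<phi>\<^sub>j\<close> is a homomorphism \<open>B\<^sup>k \<rightarrow> B\<close>. In additive notation for \<open>A\<close>, as a module over the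
group ring of \<open>B\<close>, the map \<open>F = \<Sum>\<^sub>j \<phi>\<^sub>j r\<^sub>j\<close> is an exponential sum with homomorphisms \<open>r\<^sub>j: A\<^sup>k \<rightarrow> A\<close> as
coefficients (lemma \<open>word_map_split\<close>). It suffices to show that \<open>F\<close> and \<open>b \<mapsto> w(b)\<close> have finitely many
values. Both have fewer than \<open>2\<^bsup>\<aleph>\<^sub>0\<^esup>\<close> of them, because \<open>F(b)(m) = w(m b) w(b)\<inverse>\<close> is a quotient of two
values of \<open>w\<close>.

The topological input is lemma \<open>finite_subadditive_family\<close>. Let \<open>K\<close> be a compact group and \<open>S\<^sub>e\<close>
(\<open>e \<in> K\<close>) a continuous family of finite sets with \<open>S\<^bsub>d e\<^esub> \<subseteq> p(S\<^sub>d, S\<^sub>e)\<close> for some operation \<open>p\<close>. If the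
union of the family has fewer than \<open>2\<^bsup>\<aleph>\<^sub>0\<^esup>\<close> elements, then it is finite. Indeed, by Baire's theorem the
size of \<open>S\<^sub>e\<close> is bounded on a nonempty open set, and a compact Hausdorff space with fewer than
\<open>2\<^bsup>\<aleph>\<^sub>0\<^esup>\<close> points has an isolated point, so \<open>S\<^sub>e\<close> is even constant on some nonempty open set \<open>V\<close>.
Finitely many translates of \<open>V\<close> cover \<open>K\<close>, and subadditivity bounds the family on each of them. The
case of singletons says that a continuous homomorphism on a compact group with fewer than
\<open>2\<^bsup>\<aleph>\<^sub>0\<^esup>\<close> values has finitely many; this settles \<open>b \<mapsto> w(b)\<close>.

For exponential sums (lemma \<open>finite_values_exp_sum\<close>) induct on the number of terms. The twisted
difference \<open>(\<Delta>\<^sub>e F)(b) = F(b e) - \<phi>\<^sub>1(e) F(b)\<close> is an exponential sum in which the first term has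
cancelled, so by induction its set of values \<open>S\<^sub>e\<close> is finite for each \<open>e\<close>. From
\<open>(\<Delta>\<^bsub>d e\<^esub> F)(b) = (\<Delta>\<^sub>e F)(b d) + \<phi>\<^sub>1(e) (\<Delta>\<^sub>d F)(b)\<close> it follows that \<open>S\<^bsub>d e\<^esub> \<subseteq> S\<^sub>e + S\<^sub>d\<close>, hence the union of
all \<open>S\<^sub>e\<close> is finite. Finally \<open>F(b) = (\<Delta>\<^sub>b F)(1) + \<phi>\<^sub>1(b) F(1)\<close>, and \<open>F(1)\<close> is a homomorphism with few
values.
\<close>

section \<open>Sets with fewer elements than the continuum\<close>

abbreviation below_continuum :: "'a set \<Rightarrow> bool" where
  "below_continuum S \<equiv> S \<prec> (UNIV :: nat set set)"

lemma below_continuum_subset: "below_continuum T \<Longrightarrow> S \<subseteq> T \<Longrightarrow> below_continuum S"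
  by (meson lesspoll_trans1 subset_imp_lepoll)

lemma below_continuum_image: "below_continuum S \<Longrightarrow> below_continuum (f ` S)"
  by (meson image_lepoll lesspoll_trans1)

lemma below_continuum_Times:
  assumes "below_continuum S"
  shows "below_continuum (S \<times> S)"
proof (cases "finite S")
  case True
  then show ?thesis
    by (simp add: finite_lesspoll_infinite Finite_Set.finite_set)
next
  case False
  then have "S \<times> S \<approx> S"
    by (simp add: eqpoll_iff_card_of_ordIso card_of_Times_same_infinite)
  then show ?thesis
    using assms eq_lesspoll_trans by blast
qed

lemma below_continuum_binary_image:
  assumes "below_continuum S" "\<And>z. z \<in> T \<Longrightarrow> \<exists>x\<in>S. \<exists>y\<in>S. z = p x y"
  shows "below_continuum T"
proof (rule below_continuum_subset)
  show "below_continuum ((\<lambda>(x, y). p x y) ` (S \<times> S))"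
    by (intro below_continuum_image below_continuum_Times assms(1))
  show "T \<subseteq> (\<lambda>(x, y). p x y) ` (S \<times> S)"
    using assms(2) by fastforce
qed

section \<open>Maps with few values on compact spaces\<close>

text \<open>
Otherwise \<open>S\<close> would be perfect, and nonempty perfect sets in locally compact Hausdorff spaces have at
least \<open>2\<^bsup>\<aleph>\<^sub>0\<^esup>\<close> points.
\<close>

lemma isolated_point_if_below_continuum:
  assumes "compactin X S" "Hausdorff_space X" "S \<noteq> {}" "below_continuum S"
  obtains s U where "openin X U" "U \<inter> S = {s}"
proof -
  let ?Y = "subtopology X S"
  have S: "topspace ?Y = S"
    using compactin_subset_topspace[OF assms(1)] by (rule topspace_subtopology_subset)
  have "\<not> (UNIV::real set) \<lesssim> S"
    using assms(4) nat_sets_eqpoll_reals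
    by (meson lepoll_trans1 lesspoll_not_refl lesspoll_trans1 lesspoll_trans2)
  moreover have "locally_compact_space ?Y" "Hausdorff_space ?Y"
    using assms by (auto simp: compact_imp_locally_compact_space compact_space_subtopology
        Hausdorff_space_subtopology)
  ultimately have "?Y derived_set_of S \<noteq> S"
    using lepoll_perfect_set[of ?Y S] assms(3) by blast
  then obtain s where "s \<in> S" "s \<notin> ?Y derived_set_of S"
    using derived_set_of_subset_topspace[of ?Y S] S by blast
  then obtain T where T: "openin ?Y T" "s \<in> T" "\<forall>y\<in>S. y \<in> T \<longrightarrow> y = s"
    using S by (auto simp: in_derived_set_of)
  then obtain U where "openin X U" and U: "T = U \<inter> S"
    unfolding openin_subtopology by metis
  have "U \<inter> S = {s}"
    unfolding U[symmetric] using T(2,3) U by blast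
  with that \<open>openin X U\<close> show ?thesis by blast
qed

text \<open>
The preimage of an isolated point of the image is open. Passing to a compact subset of \<open>U\<close> first
places the open set where \<open>f\<close> is constant inside \<open>U\<close>, so that the lemma can be iterated.
\<close>

lemma locally_constant_if_below_continuum:
  assumes T: "compact_space T" "Hausdorff_space T" and X: "Hausdorff_space X"
    and f: "continuous_map T X f" and U: "openin T U" "U \<noteq> {}"
    and small: "below_continuum (f ` topspace T)"
  obtains V c where "openin T V" "V \<noteq> {}" "V \<subseteq> U" "\<And>x. x \<in> V \<Longrightarrow> f x = c"
proof -
  have "neighbourhood_base_of (closedin T) T"
    using T compact_Hausdorff_imp_regular_space neighbourhood_base_of_closedin by blast
  then obtain V C where V: "openin T V" "V \<noteq> {}" "closedin T C" "V \<subseteq> C" "C \<subseteq> U"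
    using U by (metis all_not_in_conv empty_iff neighbourhood_base_of)
  \<comment> \<open>Replacing \<open>C\<close> by the closure of \<open>V\<close> matters: an isolated value of \<open>f\<close> on this set is also attained on
    \<open>V\<close>, whereas an isolated value on \<open>C\<close> might be attained only at points outside the closure of \<open>V\<close>.\<close>
  define D where "D = T closure_of V"
  have D: "V \<subseteq> D" "D \<subseteq> C"
    using V by (auto simp: D_def closure_of_subset openin_subset closure_of_minimal)
  have "compactin T D"
    using T(1) by (simp add: D_def closedin_compact_space)
  then have "compactin X (f ` D)"
    using f image_compactin by blast
  moreover have "D \<subseteq> topspace T"
    using D V closedin_subset by blast
  then have "below_continuum (f ` D)"
    using below_continuum_subset[OF small] by blast
  ultimately obtain c O' where O': "openin X O'" "O' \<inter> f ` D = {c}"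
    using isolated_point_if_below_continuum[of X "f ` D"] X V D by (metis image_is_empty subset_empty)
  define W where "W = {x \<in> topspace T. f x \<in> O'}"
  have W: "openin T W"
    using f O' by (simp add: W_def openin_continuous_map_preimage)
  obtain d where "d \<in> D" "f d = c" "c \<in> O'" using O'(2) by (metis Int_iff imageE insertI1)
  then have "d \<in> W" using \<open>D \<subseteq> topspace T\<close> by (auto simp: W_def)
  moreover have "\<forall>T'. d \<in> T' \<and> openin T T' \<longrightarrow> (\<exists>y\<in>V. y \<in> T')"
    using \<open>d \<in> D\<close> by (simp add: D_def in_closure_of Bex_def)
  ultimately have "W \<inter> V \<noteq> {}"
    using W by (metis disjoint_iff)
  moreover have "f x = c" if "x \<in> W \<inter> V" for x
    using that O' D by (auto simp: W_def)
  ultimately show thesis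
    using that[of "W \<inter> V" c] openin_Int[OF W V(1)] V(4,5) by (meson inf.coboundedI2 subset_trans)
qed

lemma locally_constant_finite_family:
  assumes T: "compact_space T" "Hausdorff_space T" and X: "Hausdorff_space X"
    and f: "\<And>y. y \<in> Y \<Longrightarrow> continuous_map T X (\<lambda>e. f e y)"
    and small: "\<And>y. y \<in> Y \<Longrightarrow> below_continuum ((\<lambda>e. f e y) ` topspace T)"
    and "finite Y" and U: "openin T U" "U \<noteq> {}"
  shows "\<exists>V c. openin T V \<and> V \<noteq> {} \<and> V \<subseteq> U \<and> (\<forall>y\<in>Y. \<forall>e\<in>V. f e y = c y)"
  using \<open>finite Y\<close> f small
proof (induction Y)
  case empty
  then show ?case using U by blast
next
  case (insert z Y)
  then obtain V c where V: "openin T V" "V \<noteq> {}" "V \<subseteq> U" "\<forall>y\<in>Y. \<forall>e\<in>V. f e y = c y"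
    by auto
  obtain V' c' where V': "openin T V'" "V' \<noteq> {}" "V' \<subseteq> V" "\<And>e. e \<in> V' \<Longrightarrow> f e z = c'"
    using locally_constant_if_below_continuum[OF T X _ V(1,2), of "\<lambda>e. f e z"] insert.prems by blast
  have "\<forall>y\<in>insert z Y. \<forall>e\<in>V'. f e y = (c(z := c')) y"
    using V(4) V'(3,4) insert.hyps by auto
  with V' V show ?case by blast
qed

text \<open>
Points where \<open>f e\<close> takes more than \<open>n\<close> values form an open set, so Baire's theorem bounds the number of
values on some nonempty open set. Around a point of it where that number is maximal, all values come from
one finite set of arguments \<open>y\<close>, and these finitely many functions \<open>e \<mapsto> f e y\<close> are simultaneously
constant on a smaller nonempty open set.
\<close>

lemma finite_family_locally_finite:
  assumes T: "compact_space T" "Hausdorff_space T" "topspace T \<noteq> {}" and X: "Hausdorff_space X"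
    and f: "\<And>y. y \<in> Y \<Longrightarrow> continuous_map T X (\<lambda>e. f e y)"
    and fin: "\<And>e. e \<in> topspace T \<Longrightarrow> finite (f e ` Y)"
    and small: "below_continuum (\<Union>e\<in>topspace T. f e ` Y)"
  obtains V where "openin T V" "V \<noteq> {}" "finite (\<Union>e\<in>V. f e ` Y)"
proof -
  have open_neq: "openin T {e \<in> topspace T. f e y \<noteq> f e z}" if "y \<in> Y" "z \<in> Y" for y z
  proof -
    have "closedin T {e \<in> topspace T. f e y = f e z}"
      using closedin_continuous_maps_eq X f that by blast
    moreover have "{e \<in> topspace T. f e y \<noteq> f e z} = topspace T - {e \<in> topspace T. f e y = f e z}"
      by blast
    ultimately show ?thesis by (simp add: openin_diff)
  qed
  have open_inj: "openin T {e \<in> topspace T. inj_on (f e) Z}" if "finite Z" "Z \<subseteq> Y" for Z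
  proof -
    have "{e \<in> topspace T. inj_on (f e) Z}
        = topspace T \<inter> (\<Inter>(y, z) \<in> {p \<in> Z \<times> Z. fst p \<noteq> snd p}. {e \<in> topspace T. f e y \<noteq> f e z})"
      by (auto simp: inj_on_def)
    also have "openin T \<dots>"
      using that open_neq by (intro openin_Int_Inter) auto
    finally show ?thesis .
  qed
  have choose: "\<exists>Z\<subseteq>Y. finite Z \<and> inj_on (f e) Z \<and> f e ` Z = f e ` Y" if "e \<in> topspace T" for e
  proof -
    obtain Z where "Z \<subseteq> Y" "inj_on (f e) Z" "f e ` Y = f e ` Z"
      using subset_image_inj[of "f e ` Y" "f e" Y] by auto
    moreover from this have "finite Z"
      using fin[OF that] by (metis finite_imageD)
    ultimately show ?thesis by metis
  qed
  define C where "C n = {e \<in> topspace T. card (f e ` Y) \<le> n}" for n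
  have closed: "closedin T (C n)" for n
  proof -
    have "openin T {e \<in> topspace T. n < card (f e ` Y)}"
    proof (subst openin_subopen, clarify)
      fix e assume e: "e \<in> topspace T" "n < card (f e ` Y)"
      obtain Z where Z: "Z \<subseteq> Y" "finite Z" "inj_on (f e) Z" "f e ` Z = f e ` Y"
        using choose e by blast
      have "{e \<in> topspace T. inj_on (f e) Z} \<subseteq> {e \<in> topspace T. n < card (f e ` Y)}"
      proof clarify
        fix e' assume e': "e' \<in> topspace T" "inj_on (f e') Z"
        have "n < card Z" using e(2) Z by (metis card_image)
        also have "card Z = card (f e' ` Z)" using e'(2) by (simp add: card_image)
        also have "\<dots> \<le> card (f e' ` Y)" using fin e' Z by (intro card_mono image_mono)
        finally show "n < card (f e' ` Y)" .
      qed
      with open_inj[OF Z(2,1)] Z(3) e(1)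
      show "\<exists>T'. openin T T' \<and> e \<in> T' \<and> T' \<subseteq> {e \<in> topspace T. n < card (f e ` Y)}" by blast
    qed
    moreover have "C n = topspace T - {e \<in> topspace T. n < card (f e ` Y)}"
      by (auto simp: C_def)
    ultimately show ?thesis by (simp add: closedin_diff)
  qed
  have "(\<Union>n. C n) = topspace T" by (auto simp: C_def)
  then have "T interior_of \<Union>(range C) \<noteq> {}" using T(3) by simp
  moreover have "locally_compact_space T \<and> regular_space T"
    using T by (simp add: compact_imp_locally_compact_space compact_Hausdorff_imp_regular_space)
  ultimately obtain n where n: "T interior_of (C n) \<noteq> {}"
    using Baire_category_alt[of T "range C"] closed by auto
  define U where "U = T interior_of (C n)"
  have U: "openin T U" "U \<noteq> {}" "U \<subseteq> C n"
    using n by (auto simp: U_def interior_of_subset)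
  \<comment> \<open>Choosing \<open>e\<close> with as many values as possible ensures that arguments with distinct values at \<open>e\<close>
    already account for all values at nearby points.\<close>
  obtain e where e: "e \<in> U" "\<And>e'. e' \<in> U \<Longrightarrow> card (f e' ` Y) \<le> card (f e ` Y)"
  proof -
    obtain e0 where "e0 \<in> U" using U by blast
    moreover have "\<forall>e. e \<in> U \<longrightarrow> card (f e ` Y) < Suc n" using U by (auto simp: C_def)
    ultimately have "\<exists>e. e \<in> U \<and> (\<forall>e'. e' \<in> U \<longrightarrow> card (f e' ` Y) \<le> card (f e ` Y))"
      by (rule ex_has_greatest_nat[of "\<lambda>e. e \<in> U" e0 "\<lambda>e. card (f e ` Y)"])
    then show thesis
      using that by metis
  qed
  have "e \<in> topspace T" using e U openin_subset by blast
  then obtain Z where Z: "Z \<subseteq> Y" "finite Z" "inj_on (f e) Z" "f e ` Z = f e ` Y"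
    using choose by blast
  define W where "W = U \<inter> {e \<in> topspace T. inj_on (f e) Z}"
  have W: "openin T W" "W \<noteq> {}"
    using openin_Int[OF U(1) open_inj[OF Z(2,1)]] e(1) Z(3) \<open>e \<in> topspace T\<close>
    unfolding W_def by blast+
  have attained: "f e' ` Y = f e' ` Z" if "e' \<in> W" for e'
  proof (rule sym, rule card_seteq)
    have "card (f e' ` Y) \<le> card (f e ` Y)" using e that by (auto simp: W_def)
    also have "\<dots> = card (f e' ` Z)" using Z that by (metis (no_types, lifting) IntD2 W_def card_image mem_Collect_eq)
    finally show "card (f e' ` Y) \<le> card (f e' ` Z)" .
    show "finite (f e' ` Y)" using fin that by (auto simp: W_def)
  qed (use Z in auto)
  have small_Z: "below_continuum ((\<lambda>e. f e y) ` topspace T)" if "y \<in> Z" for y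
  proof (rule below_continuum_subset[OF small])
    show "(\<lambda>e. f e y) ` topspace T \<subseteq> (\<Union>e\<in>topspace T. f e ` Y)"
      using that Z(1) by auto
  qed
  have f_Z: "continuous_map T X (\<lambda>e. f e y)" if "y \<in> Z" for y
    using f that Z(1) by blast
  have "\<exists>V c. openin T V \<and> V \<noteq> {} \<and> V \<subseteq> W \<and> (\<forall>y\<in>Z. \<forall>e\<in>V. f e y = c y)"
    by (rule locally_constant_finite_family[OF T(1,2) X _ _ Z(2) W]) (fact f_Z, fact small_Z)
  then obtain V c where V: "openin T V" "V \<noteq> {}" "V \<subseteq> W" "\<forall>y\<in>Z. \<forall>e\<in>V. f e y = c y"
    by (elim exE conjE)
  have "f e ` Y \<subseteq> c ` Z" if "e \<in> V" for e
    using attained[of e] V(3,4) that by (metis image_cong order_refl subsetD)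
  then have "(\<Union>e\<in>V. f e ` Y) \<subseteq> c ` Z"
    by (rule UN_least)
  then have "finite (\<Union>e\<in>V. f e ` Y)"
    using Z(2) by (meson finite_imageI finite_subset)
  with V(1,2) show thesis by (rule that)
qed

section \<open>Subadditive families on compact groups\<close>

locale compact_group = topological_group +
  assumes compact: "compact_space X" and Hausdorff: "Hausdorff_space X"
begin

lemma continuous_map_mult:
  assumes "continuous_map T X f" "continuous_map T X g"
  shows "continuous_map T X (\<lambda>t. f t \<otimes> g t)"
  using continuous_map_compose[OF continuous_map_pairedI[OF assms] continuous_mult]
  by (simp add: o_def)

lemma continuous_map_inv:
  assumes "continuous_map T X f"
  shows "continuous_map T X (\<lambda>t. inv (f t))"
  using continuous_map_compose[OF assms continuous_inv] by (simp add: o_def)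

lemma continuous_map_const_carrier: "a \<in> carrier G \<Longrightarrow> continuous_map T X (\<lambda>_. a)"
  using topspace_eq_carrier by simp

lemma open_translate:
  assumes "openin X V" "x \<in> carrier G"
  shows "openin X ((\<lambda>v. x \<otimes> v) ` V)"
proof -
  have "continuous_map X X (\<lambda>v. inv x \<otimes> v)"
    using assms(2) by (intro continuous_map_mult continuous_map_const_carrier) auto
  moreover have "V \<subseteq> carrier G"
    using assms(1) openin_subset topspace_eq_carrier by blast
  then have "(\<lambda>v. x \<otimes> v) ` V = {y \<in> topspace X. inv x \<otimes> y \<in> V}"
    using assms(2) topspace_eq_carrier
    by (force simp: image_iff m_assoc[symmetric])
  ultimately show ?thesis
    using assms(1) by (simp add: openin_continuous_map_preimage)
qed

lemma finitely_many_translates_cover: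
  assumes "openin X V" "V \<noteq> {}"
  obtains F where "finite F" "F \<subseteq> carrier G" "\<And>x. x \<in> carrier G \<Longrightarrow> \<exists>t\<in>F. \<exists>v\<in>V. x = t \<otimes> v"
proof -
  obtain v where v: "v \<in> V" "v \<in> carrier G"
    using assms openin_subset topspace_eq_carrier by blast
  have VG: "V \<subseteq> carrier G" using assms openin_subset topspace_eq_carrier by blast
  let ?\<U> = "(\<lambda>x. (\<lambda>v. x \<otimes> v) ` V) ` carrier G"
  have "\<Union>?\<U> = topspace X"
  proof (intro equalityI subsetI)
    fix y assume "y \<in> topspace X"
    then have "y \<otimes> inv v \<in> carrier G" "y = y \<otimes> inv v \<otimes> v"
      using v topspace_eq_carrier by (auto simp: m_assoc)
    then show "y \<in> \<Union>?\<U>" using v by blast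
  qed (use VG topspace_eq_carrier in auto)
  moreover have "\<forall>U\<in>?\<U>. openin X U"
    using open_translate assms by blast
  ultimately obtain \<F> where "finite \<F>" "\<F> \<subseteq> ?\<U>" "\<Union>\<F> = topspace X"
    using compact unfolding compact_space by meson
  then obtain F where "finite F" "F \<subseteq> carrier G" "(\<Union>x\<in>F. (\<lambda>v. x \<otimes> v) ` V) = topspace X"
    by (metis finite_subset_image)
  then show thesis using that[of F] topspace_eq_carrier by blast
qed

text \<open>
By the preceding section the union is finite over some nonempty open set \<open>V\<close>. Every element of the
group is a product \<open>t v\<close> with \<open>v \<in> V\<close> and \<open>t\<close> in a fixed finite set, and for each \<open>t\<close> the values at
\<open>t v\<close> are obtained by \<open>p\<close> from the finitely many at \<open>t\<close> and those over \<open>V\<close>.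
\<close>

theorem finite_subadditive_family:
  assumes Y: "Hausdorff_space Z" and f: "\<And>y. y \<in> Y \<Longrightarrow> continuous_map X Z (\<lambda>e. f e y)"
    and fin: "\<And>e. e \<in> carrier G \<Longrightarrow> finite (f e ` Y)"
    and small: "below_continuum (\<Union>e\<in>carrier G. f e ` Y)"
    and sub: "\<And>d e y. d \<in> carrier G \<Longrightarrow> e \<in> carrier G \<Longrightarrow> y \<in> Y
                \<Longrightarrow> \<exists>u\<in>f d ` Y. \<exists>v\<in>f e ` Y. f (d \<otimes> e) y = p u v"
  shows "finite (\<Union>e\<in>carrier G. f e ` Y)"
proof -
  obtain V where V: "openin X V" "V \<noteq> {}" "finite (\<Union>e\<in>V. f e ` Y)"
  proof (rule finite_family_locally_finite[of X Z Y f])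
    show "topspace X \<noteq> {}" using topspace_eq_carrier one_closed by blast
  qed (use compact Hausdorff Y f fin small in \<open>simp_all add: topspace_eq_carrier\<close>)
  obtain F where F: "finite F" "F \<subseteq> carrier G" "\<And>x. x \<in> carrier G \<Longrightarrow> \<exists>t\<in>F. \<exists>v\<in>V. x = t \<otimes> v"
    using finitely_many_translates_cover[OF V(1,2)] by metis
  have VG: "V \<subseteq> carrier G" using V openin_subset topspace_eq_carrier by blast
  have "(\<Union>e\<in>carrier G. f e ` Y) \<subseteq> (\<lambda>(u, v). p u v) ` ((\<Union>t\<in>F. f t ` Y) \<times> (\<Union>e\<in>V. f e ` Y))"
  proof clarify
    fix x y assume "x \<in> carrier G" "y \<in> Y"
    then obtain t v where tv: "t \<in> F" "v \<in> V" "x = t \<otimes> v" using F by blast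
    then obtain a b where "a \<in> f t ` Y" "b \<in> f v ` Y" "f x y = p a b"
      using sub[of t v y] F VG \<open>y \<in> Y\<close> by blast
    with tv show "f x y \<in> (\<lambda>(u, v). p u v) ` ((\<Union>t\<in>F. f t ` Y) \<times> (\<Union>e\<in>V. f e ` Y))"
      by (auto intro!: image_eqI[of _ _ "(a, b)"])
  qed
  moreover have "finite (\<Union>t\<in>F. f t ` Y)" using F fin by blast
  ultimately show ?thesis
    using V(3) by (meson finite_SigmaI finite_imageI finite_subset)
qed

corollary finite_range_hom_below_continuum:
  assumes "Hausdorff_space Z" "continuous_map X Z h" "below_continuum (h ` carrier G)"
    and "\<And>x y. x \<in> carrier G \<Longrightarrow> y \<in> carrier G \<Longrightarrow> h (x \<otimes> y) = p (h x) (h y)"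
  shows "finite (h ` carrier G)"
proof -
  have "finite (\<Union>e\<in>carrier G. (\<lambda>_. h e) ` {()})"
    using assms by (intro finite_subadditive_family[where p = p and Z = Z])
      (auto simp: image_constant_conv UNION_singleton_eq_range)
  then show ?thesis by (simp add: UNION_singleton_eq_range)
qed

end

lemma (in profinite_group) profinite_imp_compact_group: "compact_group G X"
  by unfold_locales (use compact Hausdorff in auto)

section \<open>Exponential sums\<close>

definition conjugate :: "('a, 'c) monoid_scheme \<Rightarrow> 'a \<Rightarrow> 'a \<Rightarrow> 'a" where
  "conjugate G b a = b \<otimes>\<^bsub>G\<^esub> a \<otimes>\<^bsub>G\<^esub> inv\<^bsub>G\<^esub> b"

text \<open>
With \<open>A\<close> written additively, this is \<open>\<Sum>\<^sub>t \<phi>\<^sub>t(b) r\<^sub>t(m)\<close> for the pairs \<open>t = (\<phi>\<^sub>t, r\<^sub>t)\<close> in the list.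
\<close>

primrec exp_sum ::
  "('a, 'c) monoid_scheme \<Rightarrow> (('k \<Rightarrow> 'a) \<times> ('m \<Rightarrow> 'a)) list \<Rightarrow> 'k \<Rightarrow> 'm \<Rightarrow> 'a" where
  "exp_sum G [] b m = \<one>\<^bsub>G\<^esub>"
| "exp_sum G (t # ts) b m = conjugate G (fst t b) (snd t m) \<otimes>\<^bsub>G\<^esub> exp_sum G ts b m"

text \<open>
The terms of \<open>b \<mapsto> F(b e) - \<phi>(e) F(b)\<close> for an exponential sum \<open>F\<close>: the coefficient \<open>r\<^sub>t\<close> becomes
\<open>(\<phi>\<^sub>t(e) - \<phi>(e)) r\<^sub>t\<close>, and vanishes if \<open>\<phi>\<^sub>t = \<phi>\<close>.
\<close>

definition twisted_difference ::
  "('a, 'c) monoid_scheme \<Rightarrow> ('k \<Rightarrow> 'a) \<Rightarrow> 'k \<Rightarrow> (('k \<Rightarrow> 'a) \<times> ('m \<Rightarrow> 'a)) list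
    \<Rightarrow> (('k \<Rightarrow> 'a) \<times> ('m \<Rightarrow> 'a)) list" where
  "twisted_difference G \<phi> e = map (\<lambda>t. (fst t,
     \<lambda>m. conjugate G (fst t e) (snd t m) \<otimes>\<^bsub>G\<^esub> inv\<^bsub>G\<^esub> (conjugate G (\<phi> e) (snd t m))))"

locale abelian_factors = compact_group +
  fixes A B :: "'a set"
  assumes normal_A: "A \<lhd> G" and commute_A: "\<And>x y. x \<in> A \<Longrightarrow> y \<in> A \<Longrightarrow> x \<otimes> y = y \<otimes> x"
    and subgroup_B: "subgroup B G" and commute_B: "\<And>x y. x \<in> B \<Longrightarrow> y \<in> B \<Longrightarrow> x \<otimes> y = y \<otimes> x"
begin

abbreviation conj_by :: "'a \<Rightarrow> 'a \<Rightarrow> 'a" where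
  "conj_by \<equiv> conjugate G"

lemma subgroup_A: "subgroup A G"
  using normal_A normal_imp_subgroup by blast

lemma A_closed [simp]:
  "\<one> \<in> A" "x \<in> A \<Longrightarrow> x \<in> carrier G" "x \<in> A \<Longrightarrow> inv x \<in> A"
  "x \<in> A \<Longrightarrow> y \<in> A \<Longrightarrow> x \<otimes> y \<in> A"
  using subgroup_A
  by (auto simp: subgroup.one_closed subgroup.mem_carrier subgroup.m_inv_closed subgroup.m_closed)

lemma B_closed [simp]:
  "\<one> \<in> B" "x \<in> B \<Longrightarrow> x \<in> carrier G" "x \<in> B \<Longrightarrow> inv x \<in> B"
  "x \<in> B \<Longrightarrow> y \<in> B \<Longrightarrow> x \<otimes> y \<in> B"
  using subgroup_B
  by (auto simp: subgroup.one_closed subgroup.mem_carrier subgroup.m_inv_closed subgroup.m_closed)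

lemma left_commute_A: "x \<in> A \<Longrightarrow> y \<in> A \<Longrightarrow> z \<in> A \<Longrightarrow> x \<otimes> (y \<otimes> z) = y \<otimes> (x \<otimes> z)"
  by (metis A_closed(2) commute_A m_assoc)

lemma inv_mult_A: "x \<in> A \<Longrightarrow> y \<in> A \<Longrightarrow> inv (x \<otimes> y) = inv x \<otimes> inv y"
  by (metis A_closed(2,3) commute_A inv_mult_group)

lemma assoc_A: "x \<in> A \<Longrightarrow> y \<in> A \<Longrightarrow> z \<in> A \<Longrightarrow> x \<otimes> y \<otimes> z = x \<otimes> (y \<otimes> z)"
  by (simp add: m_assoc)

lemmas abelian_simps_A = assoc_A commute_A left_commute_A inv_mult_A

lemma conj_closed_A [simp]: "b \<in> B \<Longrightarrow> a \<in> A \<Longrightarrow> conj_by b a \<in> A"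
  using normal_A by (simp add: conjugate_def normal.inv_op_closed2)

lemma conj_one [simp]: "b \<in> B \<Longrightarrow> conj_by b \<one> = \<one>"
  by (simp add: conjugate_def)

lemma conj_by_one [simp]: "a \<in> A \<Longrightarrow> conj_by \<one> a = a"
  by (simp add: conjugate_def)

lemma conj_mult: "b \<in> B \<Longrightarrow> x \<in> A \<Longrightarrow> y \<in> A \<Longrightarrow> conj_by b (x \<otimes> y) = conj_by b x \<otimes> conj_by b y"
  by (simp add: conjugate_def m_assoc inv_solve_left[symmetric] flip: m_assoc[of "inv b" b])

lemma conj_inv: "b \<in> B \<Longrightarrow> x \<in> A \<Longrightarrow> conj_by b (inv x) = inv (conj_by b x)"
  by (simp add: conjugate_def inv_mult_group m_assoc)

lemma conj_conj: "b \<in> B \<Longrightarrow> c \<in> B \<Longrightarrow> x \<in> A \<Longrightarrow> conj_by b (conj_by c x) = conj_by (b \<otimes> c) x"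
  by (simp add: conjugate_def inv_mult_group m_assoc)

lemma conj_left_commute: "b \<in> B \<Longrightarrow> c \<in> B \<Longrightarrow> x \<in> A \<Longrightarrow> conj_by b (conj_by c x) = conj_by c (conj_by b x)"
  by (simp add: conj_conj commute_B)

end

text \<open>
The operation of \<open>B\<close> on \<open>M\<close> is there for the coefficients of the sums below to commute with \<open>B\<close>: then the
set of values of each sum is stable under conjugation by \<open>B\<close>, which turns twisted differences into
quotients of two values.
\<close>

locale exponential_sums =
  abelian_factors G X A B + K: compact_group K TK + M: compact_group M TM
  for G :: "('a, 'c) monoid_scheme" (structure) and X A B
    and K :: "('k, 'd) monoid_scheme" and TK
    and M :: "('m, 'e) monoid_scheme" and TM +
  fixes act :: "'a \<Rightarrow> 'm \<Rightarrow> 'm"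
  assumes act_closed: "b \<in> B \<Longrightarrow> m \<in> carrier M \<Longrightarrow> act b m \<in> carrier M"
begin

definition character :: "('k \<Rightarrow> 'a) \<Rightarrow> bool" where
  "character \<phi> \<longleftrightarrow> \<phi> \<in> carrier K \<rightarrow> B \<and> continuous_map TK X \<phi> \<and>
     (\<forall>b\<in>carrier K. \<forall>c\<in>carrier K. \<phi> (b \<otimes>\<^bsub>K\<^esub> c) = \<phi> b \<otimes> \<phi> c)"

definition coefficient :: "('m \<Rightarrow> 'a) \<Rightarrow> bool" where
  "coefficient r \<longleftrightarrow> r \<in> carrier M \<rightarrow> A \<and> continuous_map TM X r \<and>
     (\<forall>m\<in>carrier M. \<forall>n\<in>carrier M. r (m \<otimes>\<^bsub>M\<^esub> n) = r m \<otimes> r n) \<and>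
     (\<forall>b\<in>B. \<forall>m\<in>carrier M. r (act b m) = conj_by b (r m))"

definition admissible :: "(('k \<Rightarrow> 'a) \<times> ('m \<Rightarrow> 'a)) list \<Rightarrow> bool" where
  "admissible ts \<longleftrightarrow> (\<forall>t\<in>set ts. character (fst t) \<and> coefficient (snd t))"

lemma admissible_simps [simp]:
  "admissible []"
  "admissible (t # ts) \<longleftrightarrow> character (fst t) \<and> coefficient (snd t) \<and> admissible ts"
  by (auto simp: admissible_def)

lemma characterD:
  assumes "character \<phi>"
  shows "b \<in> carrier K \<Longrightarrow> \<phi> b \<in> B" "continuous_map TK X \<phi>"
    "b \<in> carrier K \<Longrightarrow> c \<in> carrier K \<Longrightarrow> \<phi> (b \<otimes>\<^bsub>K\<^esub> c) = \<phi> b \<otimes> \<phi> c"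
  using assms by (auto simp: character_def)

lemma coefficientD:
  assumes "coefficient r"
  shows "m \<in> carrier M \<Longrightarrow> r m \<in> A" "continuous_map TM X r"
    "m \<in> carrier M \<Longrightarrow> n \<in> carrier M \<Longrightarrow> r (m \<otimes>\<^bsub>M\<^esub> n) = r m \<otimes> r n"
    "b \<in> B \<Longrightarrow> m \<in> carrier M \<Longrightarrow> r (act b m) = conj_by b (r m)"
  using assms by (auto simp: coefficient_def)

lemma exp_sum_closed [simp]:
  "admissible ts \<Longrightarrow> b \<in> carrier K \<Longrightarrow> m \<in> carrier M \<Longrightarrow> exp_sum G ts b m \<in> A"
  by (induction ts) (auto simp: characterD coefficientD)

lemma exp_sum_mult:
  assumes "admissible ts" "b \<in> carrier K" "m \<in> carrier M" "n \<in> carrier M"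
  shows "exp_sum G ts b (m \<otimes>\<^bsub>M\<^esub> n) = exp_sum G ts b m \<otimes> exp_sum G ts b n"
  using assms
  by (induction ts) (auto simp: characterD coefficientD conj_mult abelian_simps_A)

lemma exp_sum_act:
  assumes "admissible ts" "b \<in> carrier K" "m \<in> carrier M" "c \<in> B"
  shows "exp_sum G ts b (act c m) = conj_by c (exp_sum G ts b m)"
  using assms
  by (induction ts) (auto simp: characterD coefficientD conj_mult conj_left_commute[of c])

lemma continuous_map_conj:
  "continuous_map T X f \<Longrightarrow> continuous_map T X g \<Longrightarrow> continuous_map T X (\<lambda>t. conj_by (f t) (g t))"
  unfolding conjugate_def by (intro continuous_map_mult continuous_map_inv)

lemma continuous_map_exp_sum_left:
  assumes "admissible ts" "m \<in> carrier M"
  shows "continuous_map TK X (\<lambda>b. exp_sum G ts b m)"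
  using assms(1)
proof (induction ts)
  case Nil
  then show ?case using continuous_map_const_carrier[of \<one>] by simp
next
  case (Cons t ts)
  then show ?case
    using assms(2) unfolding exp_sum.simps
    by (intro continuous_map_mult continuous_map_conj continuous_map_const_carrier)
      (auto simp: characterD coefficientD)
qed

lemma continuous_map_exp_sum_right:
  assumes "admissible ts" "b \<in> carrier K"
  shows "continuous_map TM X (\<lambda>m. exp_sum G ts b m)"
  using assms(1)
proof (induction ts)
  case Nil
  then show ?case using continuous_map_const_carrier[of \<one>] by simp
next
  case (Cons t ts)
  then show ?case
    using assms(2) unfolding exp_sum.simps
    by (intro continuous_map_mult continuous_map_conj continuous_map_const_carrier)
      (auto simp: characterD coefficientD)
qed

lemma admissible_twisted_difference:
  assumes "admissible ts" "character \<phi>" "e \<in> carrier K"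
  shows "admissible (twisted_difference G \<phi> e ts)"
proof -
  have "coefficient (\<lambda>m. conj_by (\<psi> e) (r m) \<otimes> inv (conj_by (\<phi> e) (r m)))"
    if "character \<psi>" "coefficient r" for \<psi> r
    unfolding coefficient_def
  proof (intro conjI ballI)
    show "continuous_map TM X (\<lambda>m. conj_by (\<psi> e) (r m) \<otimes> inv (conj_by (\<phi> e) (r m)))"
      using that assms
      by (intro continuous_map_mult continuous_map_inv continuous_map_conj continuous_map_const_carrier)
        (auto simp: characterD coefficientD)
  qed (use that assms in \<open>auto simp: characterD coefficientD conj_mult conj_inv abelian_simps_A
        conj_left_commute[of "\<psi> e"] conj_left_commute[of "\<phi> e"]\<close>)
  then show ?thesis
    using assms by (auto simp: admissible_def twisted_difference_def)
qed

lemma exp_sum_twisted_difference: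
  assumes "admissible ts" "character \<phi>" "b \<in> carrier K" "e \<in> carrier K" "m \<in> carrier M"
  shows "exp_sum G (twisted_difference G \<phi> e ts) b m
    = exp_sum G ts (b \<otimes>\<^bsub>K\<^esub> e) m \<otimes> inv (conj_by (\<phi> e) (exp_sum G ts b m))"
  using assms(1)
proof (induction ts)
  case Nil
  then show ?case using assms by (simp add: twisted_difference_def characterD)
next
  case (Cons t ts)
  have [simp]: "fst t b \<in> B" "fst t e \<in> B" "\<phi> e \<in> B" "snd t m \<in> A" "exp_sum G ts b m \<in> A"
    "exp_sum G ts (b \<otimes>\<^bsub>K\<^esub> e) m \<in> A" "fst t (b \<otimes>\<^bsub>K\<^esub> e) = fst t b \<otimes> fst t e"
    using Cons.prems assms by (auto simp: characterD coefficientD)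
  have "exp_sum G (twisted_difference G \<phi> e (t # ts)) b m
      = conj_by (fst t b) (conj_by (fst t e) (snd t m) \<otimes> inv (conj_by (\<phi> e) (snd t m)))
        \<otimes> (exp_sum G ts (b \<otimes>\<^bsub>K\<^esub> e) m \<otimes> inv (conj_by (\<phi> e) (exp_sum G ts b m)))"
    using Cons by (simp add: twisted_difference_def)
  also have "\<dots> = exp_sum G (t # ts) (b \<otimes>\<^bsub>K\<^esub> e) m \<otimes> inv (conj_by (\<phi> e) (exp_sum G (t # ts) b m))"
    by (simp add: conj_mult conj_inv conj_left_commute[of "\<phi> e"] abelian_simps_A flip: conj_conj)
  finally show ?case .
qed

text \<open>
Dropping the term whose character is the twisting one loses nothing, since its contributions to
\<open>F(b e)\<close> and to \<open>\<phi>(e) F(b)\<close> agree. This is what makes the induction on the number of terms work.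
\<close>

lemma exp_sum_twisted_difference_tail:
  assumes "admissible (t # ts)" "b \<in> carrier K" "e \<in> carrier K" "m \<in> carrier M"
  shows "exp_sum G (twisted_difference G (fst t) e ts) b m
    = exp_sum G (t # ts) (b \<otimes>\<^bsub>K\<^esub> e) m \<otimes> inv (conj_by (fst t e) (exp_sum G (t # ts) b m))"
proof -
  have [simp]: "fst t b \<in> B" "fst t e \<in> B" "snd t m \<in> A" "exp_sum G ts b m \<in> A"
    "exp_sum G ts (b \<otimes>\<^bsub>K\<^esub> e) m \<in> A" "fst t (b \<otimes>\<^bsub>K\<^esub> e) = fst t b \<otimes> fst t e"
    using assms by (auto simp: characterD coefficientD)
  have cancel: "(x \<otimes> p) \<otimes> inv (x \<otimes> q) = p \<otimes> inv q" if "x \<in> A" "p \<in> A" "q \<in> A" for x p q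
  proof -
    have "(x \<otimes> p) \<otimes> inv (x \<otimes> q) = (x \<otimes> inv x) \<otimes> (p \<otimes> inv q)"
      using that by (simp only: abelian_simps_A A_closed)
    then show ?thesis using that by simp
  qed
  show ?thesis
    using assms
    by (simp add: exp_sum_twisted_difference conj_mult cancel conj_conj commute_B[of "fst t e" "fst t b"])
qed

text \<open>
Induction on the number of terms. For each \<open>e\<close> the twisted difference \<open>D e\<close> by the first character has
one term less and hence finitely many values; its values are quotients of values of \<open>F\<close>, so there are
few of them even when \<open>e\<close> varies. The cocycle identity of twisted differences makes the family
\<open>D\<close> subadditive, so it has finitely many values altogether, and \<open>F\<close> is recovered from \<open>D\<close> and
\<open>F \<one>\<close>.
\<close>

theorem finite_values_exp_sum:
  assumes "admissible ts"
    and "below_continuum ((\<lambda>(b, m). exp_sum G ts b m) ` (carrier K \<times> carrier M))"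
  shows "finite ((\<lambda>(b, m). exp_sum G ts b m) ` (carrier K \<times> carrier M))"
  using assms
proof (induction "length ts" arbitrary: ts)
  case 0
  then have "(\<lambda>(b, m). exp_sum G ts b m) ` (carrier K \<times> carrier M) \<subseteq> {\<one>}" by auto
  then show ?case using finite_subset by blast
next
  case (Suc n)
  then obtain t us where ts: "ts = t # us" "length us = n"
    by (metis length_Suc_conv)
  define \<phi> where "\<phi> = fst t"
  define F where "F = exp_sum G ts"
  define D where "D e = (\<lambda>(b, m). exp_sum G (twisted_difference G \<phi> e us) b m)" for e
  let ?Y = "carrier K \<times> carrier M"
  have \<phi>: "character \<phi>" and us: "admissible us"
    using Suc.prems(1) by (auto simp: ts \<phi>_def)
  have [simp]: "\<phi> b \<in> B" if "b \<in> carrier K" for b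
    using \<phi> that characterD by blast
  have F_closed [simp]: "F b m \<in> A" if "b \<in> carrier K" "m \<in> carrier M" for b m
    using that Suc.prems(1) by (simp add: F_def)
  have F_act: "F b (act c m) = conj_by c (F b m)" if "b \<in> carrier K" "m \<in> carrier M" "c \<in> B" for b m c
    using that Suc.prems(1) by (simp add: F_def exp_sum_act)
  have D: "D e (b, m) = F (b \<otimes>\<^bsub>K\<^esub> e) m \<otimes> inv (conj_by (\<phi> e) (F b m))"
    if "b \<in> carrier K" "m \<in> carrier M" "e \<in> carrier K" for b m e
    using exp_sum_twisted_difference_tail[of t us b e m] Suc.prems(1) that
    by (simp add: D_def F_def \<phi>_def ts)
  have small: "below_continuum (\<Union>e\<in>carrier K. D e ` ?Y)"
  proof (rule below_continuum_binary_image[OF Suc.prems(2), where p = "\<lambda>x y. x \<otimes> inv y"])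
    fix z assume "z \<in> (\<Union>e\<in>carrier K. D e ` ?Y)"
    then obtain e b m where *: "e \<in> carrier K" "b \<in> carrier K" "m \<in> carrier M" "z = D e (b, m)"
      by auto
    then have "z = F (b \<otimes>\<^bsub>K\<^esub> e) m \<otimes> inv (F b (act (\<phi> e) m))"
      by (simp add: D F_act)
    moreover have "(b \<otimes>\<^bsub>K\<^esub> e, m) \<in> ?Y" "(b, act (\<phi> e) m) \<in> ?Y"
      using * act_closed by auto
    ultimately show "\<exists>x\<in>(\<lambda>(b, m). exp_sum G ts b m) ` ?Y. \<exists>y\<in>(\<lambda>(b, m). exp_sum G ts b m) ` ?Y.
        z = x \<otimes> inv y"
      unfolding F_def by blast
  qed
  have fin: "finite (D e ` ?Y)" if "e \<in> carrier K" for e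
    unfolding D_def
  proof (rule Suc.hyps(1))
    show "n = length (twisted_difference G \<phi> e us)"
      by (simp add: twisted_difference_def ts)
    show "admissible (twisted_difference G \<phi> e us)"
      using admissible_twisted_difference us \<phi> that by blast
    have "D e ` ?Y \<subseteq> (\<Union>e\<in>carrier K. D e ` ?Y)" using that by blast
    then show "below_continuum ((\<lambda>(b, m). exp_sum G (twisted_difference G \<phi> e us) b m) ` ?Y)"
      using below_continuum_subset[OF small] unfolding D_def by blast
  qed
  have "finite (\<Union>e\<in>carrier K. D e ` ?Y)"
  proof (rule K.finite_subadditive_family[OF Hausdorff _ fin small, where p = "\<lambda>u v. v \<otimes> u"])
    fix y assume "y \<in> ?Y"
    then obtain b m where y: "y = (b, m)" "b \<in> carrier K" "m \<in> carrier M" by auto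
    have "continuous_map TK TK (\<lambda>e. b \<otimes>\<^bsub>K\<^esub> e)"
      using y by (intro K.continuous_map_mult K.continuous_map_const_carrier) auto
    moreover have "continuous_map TK X (\<lambda>b. F b m)"
      using continuous_map_exp_sum_left Suc.prems(1) y by (simp add: F_def)
    ultimately have "continuous_map TK X (\<lambda>e. F (b \<otimes>\<^bsub>K\<^esub> e) m)"
      using continuous_map_compose[of TK TK "\<lambda>e. b \<otimes>\<^bsub>K\<^esub> e" X "\<lambda>b. F b m"] by (simp add: o_def)
    then have "continuous_map TK X (\<lambda>e. F (b \<otimes>\<^bsub>K\<^esub> e) m \<otimes> inv (conj_by (\<phi> e) (F b m)))"
      using \<phi> y
      by (intro continuous_map_mult continuous_map_inv continuous_map_conj continuous_map_const_carrier)
        (auto simp: characterD)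
    then show "continuous_map TK X (\<lambda>e. D e y)"
      by (rule continuous_map_eq) (use y D K.topspace_eq_carrier in auto)
  next
    \<comment> \<open>The cocycle identity of twisted differences.\<close>
    fix d e y assume de: "d \<in> carrier K" "e \<in> carrier K" and "y \<in> ?Y"
    then obtain b m where y: "y = (b, m)" "b \<in> carrier K" "m \<in> carrier M" by auto
    have cancel: "x \<otimes> inv z = (x \<otimes> inv y) \<otimes> (y \<otimes> inv z)" if "x \<in> A" "y \<in> A" "z \<in> A" for x y z
      using that by (metis A_closed(2,3) inv_solve_right m_assoc m_closed)
    have "D (d \<otimes>\<^bsub>K\<^esub> e) y = F (b \<otimes>\<^bsub>K\<^esub> d \<otimes>\<^bsub>K\<^esub> e) m \<otimes> inv (conj_by (\<phi> e) (conj_by (\<phi> d) (F b m)))"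
      using de y \<phi> by (simp add: D characterD(3) conj_conj commute_B[of "\<phi> e"] K.m_assoc)
    also have "\<dots> = D e (b \<otimes>\<^bsub>K\<^esub> d, m) \<otimes> D d (b, act (\<phi> e) m)"
    proof -
      have "D d (b, act (\<phi> e) m)
          = conj_by (\<phi> e) (F (b \<otimes>\<^bsub>K\<^esub> d) m) \<otimes> inv (conj_by (\<phi> e) (conj_by (\<phi> d) (F b m)))"
        using de y act_closed by (simp add: D F_act conj_left_commute[of "\<phi> d" "\<phi> e"])
      moreover have "D e (b \<otimes>\<^bsub>K\<^esub> d, m)
          = F (b \<otimes>\<^bsub>K\<^esub> d \<otimes>\<^bsub>K\<^esub> e) m \<otimes> inv (conj_by (\<phi> e) (F (b \<otimes>\<^bsub>K\<^esub> d) m))"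
        using de y by (simp add: D)
      ultimately show ?thesis
        by (simp only:) (intro cancel; use de y in simp)
    qed
    finally show "\<exists>u\<in>D d ` ?Y. \<exists>v\<in>D e ` ?Y. D (d \<otimes>\<^bsub>K\<^esub> e) y = v \<otimes> u"
      using de y act_closed by (intro bexI[of _ "D d (b, act (\<phi> e) m)"] bexI[of _ "D e (b \<otimes>\<^bsub>K\<^esub> d, m)"]) auto
  qed
  moreover have "finite (F \<one>\<^bsub>K\<^esub> ` carrier M)"
  proof (rule M.finite_range_hom_below_continuum[OF Hausdorff])
    show "continuous_map TM X (F \<one>\<^bsub>K\<^esub>)"
      using continuous_map_exp_sum_right Suc.prems(1) by (simp add: F_def)
    have "F \<one>\<^bsub>K\<^esub> ` carrier M \<subseteq> (\<lambda>(b, m). exp_sum G ts b m) ` ?Y"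
      by (force simp: F_def)
    then show "below_continuum (F \<one>\<^bsub>K\<^esub> ` carrier M)"
      using below_continuum_subset Suc.prems(2) by blast
    show "F \<one>\<^bsub>K\<^esub> (m \<otimes>\<^bsub>M\<^esub> n) = F \<one>\<^bsub>K\<^esub> m \<otimes> F \<one>\<^bsub>K\<^esub> n" if "m \<in> carrier M" "n \<in> carrier M" for m n
      using that exp_sum_mult Suc.prems(1) by (simp add: F_def)
  qed
  ultimately have "finite ((\<lambda>(u, v). u \<otimes> v) ` ((\<Union>e\<in>carrier K. D e ` ?Y) \<times> F \<one>\<^bsub>K\<^esub> ` carrier M))"
    by blast
  moreover have "(\<lambda>(b, m). F b m) ` ?Y
      \<subseteq> (\<lambda>(u, v). u \<otimes> v) ` ((\<Union>e\<in>carrier K. D e ` ?Y) \<times> F \<one>\<^bsub>K\<^esub> ` carrier M)"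
  proof clarify
    fix b m assume bm: "b \<in> carrier K" "m \<in> carrier M"
    have "F b m = D b (\<one>\<^bsub>K\<^esub>, m) \<otimes> F \<one>\<^bsub>K\<^esub> (act (\<phi> b) m)"
      using bm by (simp add: D F_act m_assoc)
    moreover have "D b (\<one>\<^bsub>K\<^esub>, m) \<in> (\<Union>e\<in>carrier K. D e ` ?Y)"
      using bm by blast
    moreover have "F \<one>\<^bsub>K\<^esub> (act (\<phi> b) m) \<in> F \<one>\<^bsub>K\<^esub> ` carrier M"
      using bm act_closed by simp
    ultimately show "F b m \<in> (\<lambda>(u, v). u \<otimes> v) ` ((\<Union>e\<in>carrier K. D e ` ?Y) \<times> F \<one>\<^bsub>K\<^esub> ` carrier M)"
      by force
  qed
  ultimately show ?case
    unfolding F_def by (rule finite_subset[rotated])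
qed

end

section \<open>Closed subgroups and products of compact groups\<close>

lemma (in compact_group) compact_group_subgroup:
  assumes "subgroup H G" "closedin X H"
  shows "compact_group (G\<lparr>carrier := H\<rparr>) (subtopology X H)"
proof -
  have H: "topspace (subtopology X H) = H"
    by (rule topspace_subtopology_subset) (rule closedin_subset[OF assms(2)])
  have sub: "continuous_map (subtopology X H) X (\<lambda>x. x)"
    by (rule continuous_map_from_subtopology) simp
  have "group (G\<lparr>carrier := H\<rparr>)"
    using assms(1) by (simp add: subgroup.subgroup_is_group is_group)
  moreover have "topological_group_axioms (G\<lparr>carrier := H\<rparr>) (subtopology X H)"
  proof
    show "topspace (subtopology X H) = carrier (G\<lparr>carrier := H\<rparr>)" unfolding H by simp
    have "continuous_map (prod_topology (subtopology X H) (subtopology X H)) X (\<lambda>p. fst p \<otimes> snd p)"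
      using continuous_map_compose[OF continuous_map_fst sub] continuous_map_compose[OF continuous_map_snd sub]
      by (intro continuous_map_mult) (simp_all add: o_def)
    then show "continuous_map (prod_topology (subtopology X H) (subtopology X H)) (subtopology X H)
        (\<lambda>(x, y). x \<otimes>\<^bsub>G\<lparr>carrier := H\<rparr>\<^esub> y)"
      using assms(1)
      by (auto simp: continuous_map_in_subtopology H case_prod_unfold subgroup.m_closed)
    have "continuous_map (subtopology X H) (subtopology X H) (\<lambda>x. inv x)"
      using assms(1) continuous_map_inv[OF sub]
      by (auto simp: continuous_map_in_subtopology H subgroup.m_inv_closed)
    then show "continuous_map (subtopology X H) (subtopology X H) (\<lambda>x. inv\<^bsub>G\<lparr>carrier := H\<rparr>\<^esub> x)"
      by (rule continuous_map_eq) (use assms(1) H in \<open>simp add: m_inv_consistent\<close>)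
  qed
  moreover have "compact_group_axioms (subtopology X H)"
    using assms(2) compact Hausdorff
    by unfold_locales
      (auto simp: closedin_compact_space compact_space_subtopology Hausdorff_space_subtopology)
  ultimately show ?thesis
    by (simp add: compact_group_def topological_group_def)
qed

lemma compact_group_product:
  assumes "\<And>i. i \<in> I \<Longrightarrow> compact_group (G i) (X i)"
  shows "compact_group (product_group I G) (product_topology X I)"
proof -
  let ?P = "product_topology X I"
  have grp: "group (G i)" and car: "topspace (X i) = carrier (G i)" if "i \<in> I" for i
    using assms[OF that]
    by (auto simp: compact_group_def topological_group_def topological_group_axioms_def)
  have P: "topspace ?P = (\<Pi>\<^sub>E i\<in>I. carrier (G i))"
    unfolding topspace_product_topology by (rule PiE_cong) (simp add: car)
  have proj: "continuous_map T (X i) (\<lambda>t. f t i)" if "continuous_map T ?P f" "i \<in> I" for T f i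
    using that by (simp add: continuous_map_componentwise)
  have "group (product_group I G)"
    using grp by simp
  moreover have "topological_group_axioms (product_group I G) ?P"
  proof
    show "topspace ?P = carrier (product_group I G)" unfolding P by simp
    have "continuous_map (prod_topology ?P ?P) (X i) (\<lambda>p. fst p i \<otimes>\<^bsub>G i\<^esub> snd p i)" if "i \<in> I" for i
      using that by (intro compact_group.continuous_map_mult[OF assms] proj continuous_map_fst continuous_map_snd)
    then show "continuous_map (prod_topology ?P ?P) ?P (\<lambda>(x, y). x \<otimes>\<^bsub>product_group I G\<^esub> y)"
      by (auto simp: continuous_map_componentwise case_prod_unfold)
    have "continuous_map ?P (X i) (\<lambda>x. inv\<^bsub>G i\<^esub> (x i))" if "i \<in> I" for i
      using that by (intro compact_group.continuous_map_inv[OF assms] continuous_map_product_projection)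
    then have "continuous_map ?P ?P (\<lambda>x. \<lambda>i\<in>I. inv\<^bsub>G i\<^esub> (x i))"
      by (auto simp: continuous_map_componentwise)
    then show "continuous_map ?P ?P (\<lambda>x. inv\<^bsub>product_group I G\<^esub> x)"
      by (rule continuous_map_eq) (use P grp in simp)
  qed
  moreover have "compact_space ?P" "Hausdorff_space ?P"
    using assms
    by (auto simp: compact_space_product_topology Hausdorff_space_product_topology compact_group_def
        compact_group_axioms_def)
  then have "compact_group_axioms ?P"
    by unfold_locales
  ultimately show ?thesis
    by (simp add: compact_group_def topological_group_def)
qed

section \<open>Word maps on products of abelian subgroups\<close>

text \<open>
The exponential sum contributed by the components in \<open>A\<close>. Pulling these components to the left through
the components in \<open>B\<close> conjugates the letter \<open>x\<close> by the value at \<open>b\<close> of the prefix before it, and in the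
case of an inverse letter by that of the prefix including it, as \<open>(m b)\<inverse> = b\<inverse> m\<inverse>\<close> already has
\<open>b\<inverse>\<close> on the left.
\<close>

primrec word_terms ::
  "('a, 'c) monoid_scheme \<Rightarrow> letter list \<Rightarrow> (((nat \<Rightarrow> 'a) \<Rightarrow> 'a) \<times> ((nat \<Rightarrow> 'a) \<Rightarrow> 'a)) list" where
  "word_terms G [] = []"
| "word_terms G (x # w) =
     (\<lambda>b. if snd x then letter_value G b x else \<one>\<^bsub>G\<^esub>, \<lambda>m. letter_value G m x)
       # map (\<lambda>t. (\<lambda>b. letter_value G b x \<otimes>\<^bsub>G\<^esub> fst t b, snd t)) (word_terms G w)"

context abelian_factors
begin

lemma letter_value_B [simp]: "b (fst x) \<in> B \<Longrightarrow> letter_value G b x \<in> B"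
  by (cases x) auto

lemma letter_value_A [simp]: "m (fst x) \<in> A \<Longrightarrow> letter_value G m x \<in> A"
  by (cases x) auto

lemma inv_mult_B: "x \<in> B \<Longrightarrow> y \<in> B \<Longrightarrow> inv (x \<otimes> y) = inv x \<otimes> inv y"
  by (metis B_closed(2,3) commute_B inv_mult_group)

lemma letter_value_mult_B:
  "b (fst x) \<in> B \<Longrightarrow> c (fst x) \<in> B \<Longrightarrow> d (fst x) = b (fst x) \<otimes> c (fst x)
    \<Longrightarrow> letter_value G d x = letter_value G b x \<otimes> letter_value G c x"
  by (cases x) (auto simp: inv_mult_B)

lemma letter_value_mult_A:
  "m (fst x) \<in> A \<Longrightarrow> n (fst x) \<in> A \<Longrightarrow> d (fst x) = m (fst x) \<otimes> n (fst x)
    \<Longrightarrow> letter_value G d x = letter_value G m x \<otimes> letter_value G n x"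
  by (cases x) (auto simp: inv_mult_A)

lemma word_map_B:
  "(\<And>x. x \<in> set w \<Longrightarrow> b (fst x) \<in> B) \<Longrightarrow> word_map G w b \<in> B"
  by (induction w) (auto simp: word_map_def)

lemma word_map_mult_B:
  assumes "\<And>x. x \<in> set w \<Longrightarrow> b (fst x) \<in> B \<and> c (fst x) \<in> B \<and> d (fst x) = b (fst x) \<otimes> c (fst x)"
  shows "word_map G w d = word_map G w b \<otimes> word_map G w c"
  using assms
proof (induction w)
  case (Cons x w)
  have [simp]: "word_map G w b \<in> B" "word_map G w c \<in> B" "letter_value G b x \<in> B" "letter_value G c x \<in> B"
    using Cons.prems by (auto intro!: word_map_B)
  have "word_map G (x # w) d = letter_value G b x \<otimes> letter_value G c x \<otimes> (word_map G w b \<otimes> word_map G w c)"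
    using Cons letter_value_mult_B[of b x c d] by (simp add: word_map_def)
  also have "\<dots> = (letter_value G b x \<otimes> word_map G w b) \<otimes> (letter_value G c x \<otimes> word_map G w c)"
    by (metis B_closed(2,4) commute_B m_assoc \<open>word_map G w b \<in> B\<close> \<open>letter_value G b x \<in> B\<close>
        \<open>word_map G w c \<in> B\<close> \<open>letter_value G c x \<in> B\<close>)
  finally show ?case by (simp add: word_map_def)
qed (simp add: word_map_def)

lemma conj_mult_right: "b \<in> B \<Longrightarrow> a \<in> A \<Longrightarrow> c \<in> carrier G \<Longrightarrow> b \<otimes> (a \<otimes> c) = conj_by b a \<otimes> (b \<otimes> c)"
  by (simp add: conjugate_def m_assoc flip: m_assoc[of "inv b" b])

lemma letter_value_split:
  assumes "m (fst x) \<in> A" "b (fst x) \<in> B" "g (fst x) = m (fst x) \<otimes> b (fst x)"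
  shows "letter_value G g x
    = conj_by (if snd x then letter_value G b x else \<one>) (letter_value G m x) \<otimes> letter_value G b x"
proof (cases x)
  case (Pair i s)
  have "inv (b i) \<otimes> inv (m i) = conj_by (inv (b i)) (inv (m i)) \<otimes> inv (b i)"
    using conj_mult_right[of "inv (b i)" "inv (m i)" \<one>] assms by (simp add: Pair)
  then show ?thesis
    using assms by (auto simp: Pair inv_mult_group)
qed

lemma exp_sum_closed_pointwise:
  "\<forall>t\<in>set ts. fst t b \<in> B \<and> snd t m \<in> A \<Longrightarrow> exp_sum G ts b m \<in> A"
  by (induction ts) auto

lemma exp_sum_translate_characters:
  assumes "\<forall>t\<in>set ts. fst t b \<in> B \<and> snd t m \<in> A" "\<psi> b \<in> B"
  shows "exp_sum G (map (\<lambda>t. (\<lambda>b. \<psi> b \<otimes> fst t b, snd t)) ts) b m = conj_by (\<psi> b) (exp_sum G ts b m)"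
  using assms by (induction ts) (auto simp: conj_mult conj_conj exp_sum_closed_pointwise)

lemma word_terms_values:
  assumes "\<And>x. x \<in> set w \<Longrightarrow> m (fst x) \<in> A \<and> b (fst x) \<in> B"
  shows "\<forall>t\<in>set (word_terms G w). fst t b \<in> B \<and> snd t m \<in> A"
  using assms by (induction w) auto

theorem word_map_split:
  assumes "\<And>x. x \<in> set w \<Longrightarrow>
    m (fst x) \<in> A \<and> b (fst x) \<in> B \<and> g (fst x) = m (fst x) \<otimes> b (fst x)"
  shows "word_map G w g = exp_sum G (word_terms G w) b m \<otimes> word_map G w b"
  using assms
proof (induction w)
  case (Cons x w)
  let ?l = "letter_value G b x" and ?F = "exp_sum G (word_terms G w) b m"
  define a where "a = conj_by (if snd x then ?l else \<one>) (letter_value G m x)"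
  have terms: "\<forall>t\<in>set (word_terms G w). fst t b \<in> B \<and> snd t m \<in> A"
    using Cons.prems by (intro word_terms_values) auto
  have closed: "?l \<in> B" "?F \<in> A" "a \<in> A" "word_map G w b \<in> B"
    using Cons.prems terms by (auto simp: a_def exp_sum_closed_pointwise intro!: word_map_B)
  have "word_map G (x # w) g = a \<otimes> ?l \<otimes> (?F \<otimes> word_map G w b)"
    using Cons letter_value_split[of m x b g] by (simp add: word_map_def a_def)
  also have "\<dots> = a \<otimes> conj_by ?l ?F \<otimes> (?l \<otimes> word_map G w b)"
    using closed by (simp add: m_assoc conj_mult_right)
  also have "a \<otimes> conj_by ?l ?F = exp_sum G (word_terms G (x # w)) b m"
    using exp_sum_translate_characters[OF terms, of "\<lambda>b. letter_value G b x"] closed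
    by (simp add: a_def)
  finally show ?case by (simp add: word_map_def)
qed (simp add: word_map_def)

end

locale closed_abelian_factors = abelian_factors +
  fixes k :: nat
  assumes closed_A: "closedin X A" and closed_B: "closedin X B"
begin

abbreviation tuples :: "'a set \<Rightarrow> (nat \<Rightarrow> 'a) monoid" where
  "tuples S \<equiv> product_group {..<k} (\<lambda>_. G\<lparr>carrier := S\<rparr>)"

abbreviation tuples_topology :: "'a set \<Rightarrow> (nat \<Rightarrow> 'a) topology" where
  "tuples_topology S \<equiv> product_topology (\<lambda>_. subtopology X S) {..<k}"

definition conj_tuple :: "'a \<Rightarrow> (nat \<Rightarrow> 'a) \<Rightarrow> nat \<Rightarrow> 'a" where
  "conj_tuple b m = (\<lambda>i\<in>{..<k}. conj_by b (m i))"

lemma tuples_mem [simp]: "f \<in> {..<k} \<rightarrow>\<^sub>E S \<Longrightarrow> i < k \<Longrightarrow> f i \<in> S"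
  by auto

sublocale exponential_sums G X A B "tuples B" "tuples_topology B" "tuples A" "tuples_topology A" conj_tuple
proof (intro exponential_sums.intro abelian_factors_axioms exponential_sums_axioms.intro)
  show "compact_group (tuples B) (tuples_topology B)"
    by (intro compact_group_product compact_group_subgroup subgroup_B closed_B)
  show "compact_group (tuples A) (tuples_topology A)"
    by (intro compact_group_product compact_group_subgroup subgroup_A closed_A)
  show "conj_tuple b m \<in> carrier (tuples A)"
    if "b \<in> B" "m \<in> carrier (tuples A)" for b m
    using that by (auto simp: conj_tuple_def)
qed

lemma continuous_map_letter_value:
  assumes "fst x < k"
  shows "continuous_map (tuples_topology S) X (\<lambda>b. letter_value G b x)"
proof -
  have "continuous_map (tuples_topology S) (subtopology X S) (\<lambda>b. b (fst x))"
    using assms by (intro continuous_map_product_projection) auto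
  then have "continuous_map (tuples_topology S) X (\<lambda>b. b (fst x))"
    by (simp add: continuous_map_in_subtopology)
  then show ?thesis
    using continuous_map_inv by (cases x) auto
qed

lemma character_letter_value: "fst x < k \<Longrightarrow> character (\<lambda>b. letter_value G b x)"
  unfolding character_def
proof (intro conjI ballI Pi_I)
  fix b c
  assume "fst x < k" "b \<in> carrier (tuples B)"
    "c \<in> carrier (tuples B)"
  then show "letter_value G (b \<otimes>\<^bsub>tuples B\<^esub> c) x
      = letter_value G b x \<otimes> letter_value G c x"
    by (intro letter_value_mult_B) (simp_all)
qed (simp_all add: continuous_map_letter_value)

lemma character_one: "character (\<lambda>_. \<one>)"
  unfolding character_def using continuous_map_const_carrier[of \<one>] by simp

lemma character_mult:
  assumes "character \<phi>" "character \<psi>"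
  shows "character (\<lambda>b. \<phi> b \<otimes> \<psi> b)"
  unfolding character_def
proof (intro conjI ballI)
  fix b c assume bc: "b \<in> carrier (tuples B)"
    "c \<in> carrier (tuples B)"
  have "(p \<otimes> q) \<otimes> (r \<otimes> s) = (p \<otimes> r) \<otimes> (q \<otimes> s)" if "p \<in> B" "q \<in> B" "r \<in> B" "s \<in> B" for p q r s
    using that by (metis B_closed(2,4) commute_B m_assoc)
  then show "\<phi> (b \<otimes>\<^bsub>tuples B\<^esub> c)
      \<otimes> \<psi> (b \<otimes>\<^bsub>tuples B\<^esub> c) = \<phi> b \<otimes> \<psi> b \<otimes> (\<phi> c \<otimes> \<psi> c)"
    using assms[THEN characterD(1)] assms[THEN characterD(3)] bc by metis
qed (use assms in \<open>auto simp: characterD intro!: continuous_map_mult\<close>)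

lemma coefficient_letter_value: "fst x < k \<Longrightarrow> coefficient (\<lambda>m. letter_value G m x)"
  unfolding coefficient_def
proof (intro conjI ballI Pi_I)
  fix b m assume "fst x < k" "b \<in> B" "m \<in> carrier (tuples A)"
  then show "letter_value G (conj_tuple b m) x = conj_by b (letter_value G m x)"
    by (cases x) (auto simp: conj_tuple_def conj_inv)
next
  fix m n
  assume "fst x < k" "m \<in> carrier (tuples A)"
    "n \<in> carrier (tuples A)"
  then show "letter_value G (m \<otimes>\<^bsub>tuples A\<^esub> n) x
      = letter_value G m x \<otimes> letter_value G n x"
    by (intro letter_value_mult_A) (simp_all)
qed (simp_all add: continuous_map_letter_value)

lemma admissible_word_terms:
  "(\<And>x. x \<in> set w \<Longrightarrow> fst x < k) \<Longrightarrow> admissible (word_terms G w)"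
proof (induction w)
  case (Cons x w)
  then have x: "fst x < k" by simp
  then have "character (\<lambda>b. if snd x then letter_value G b x else \<one>)"
    by (cases "snd x") (simp_all add: character_letter_value character_one)
  moreover have "admissible (map (\<lambda>t. (\<lambda>b. letter_value G b x \<otimes> fst t b, snd t)) (word_terms G w))"
    using Cons.IH Cons.prems unfolding admissible_def
    by (auto intro!: character_mult character_letter_value x)
  ultimately show ?case
    using Cons.prems by (simp add: coefficient_letter_value)
qed simp

text \<open>
By \<open>word_map_split\<close> every value of \<open>w\<close> is the product of a value of the exponential sum and a value of
\<open>w\<close> on \<open>B\<close>. The former are quotients \<open>w(m b) w(b)\<inverse>\<close> of values of \<open>w\<close>, so both kinds are few and
therefore finite in number.
\<close>

theorem finite_word_values:
  assumes w: "\<And>x. x \<in> set w \<Longrightarrow> fst x < k"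
    and G: "carrier G = A <#> B" and small: "below_continuum (word_values G k w)"
  shows "finite (word_values G k w)"
proof -
  let ?K = "{..<k} \<rightarrow>\<^sub>E B" and ?M = "{..<k} \<rightarrow>\<^sub>E A"
  let ?F = "exp_sum G (word_terms G w)"
  have K: "carrier (tuples B) = ?K"
    and M: "carrier (tuples A) = ?M" by simp_all
  have adm: "admissible (word_terms G w)"
    using w by (rule admissible_word_terms)
  have split: "word_map G w g = ?F b m \<otimes> word_map G w b"
    if "b \<in> ?K" "m \<in> ?M" "\<And>i. i < k \<Longrightarrow> g i = m i \<otimes> b i" for b m g
    using w that by (intro word_map_split) (auto)
  have wB: "word_map G w b \<in> B" if "b \<in> ?K" for b
    using w that by (intro word_map_B) (auto)
  have values_B: "word_map G w b \<in> word_values G k w" if "b \<in> ?K" for b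
    using that unfolding word_values_def by (intro imageI) (auto simp: PiE_iff)
  have F: "?F b m \<in> A" if "b \<in> ?K" "m \<in> ?M" for b m
    using that adm exp_sum_closed unfolding K M by blast
  have "below_continuum ((\<lambda>(b, m). ?F b m) ` (?K \<times> ?M))"
  proof (rule below_continuum_binary_image[OF small, where p = "\<lambda>x y. x \<otimes> inv y"], clarify)
    fix b m assume bm: "b \<in> ?K" "m \<in> ?M"
    define g where "g = (\<lambda>i\<in>{..<k}. m i \<otimes> b i)"
    have "g \<in> {..<k} \<rightarrow>\<^sub>E carrier G"
      using bm by (auto simp: g_def PiE_iff)
    then have "word_map G w g \<in> word_values G k w" by (simp add: word_values_def)
    moreover have "?F b m = word_map G w g \<otimes> inv (word_map G w b)"
      using split[OF bm, of g] F[OF bm] wB bm by (simp add: g_def m_assoc)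
    ultimately show "\<exists>x\<in>word_values G k w. \<exists>y\<in>word_values G k w. ?F b m = x \<otimes> inv y"
      using values_B bm by blast
  qed
  then have "finite ((\<lambda>(b, m). ?F b m) ` (?K \<times> ?M))"
    using finite_values_exp_sum[OF adm] unfolding K M by blast
  moreover have "finite (word_map G w ` ?K)"
    unfolding K[symmetric]
  proof (rule K.finite_range_hom_below_continuum[OF Hausdorff, where p = "(\<otimes>)"], unfold K)
    show "continuous_map (tuples_topology B) X (word_map G w)"
      using w
    proof (induction w)
      case Nil
      then show ?case using continuous_map_const_carrier[of \<one>] by (simp add: word_map_def)
    next
      case (Cons x w)
      then have "continuous_map (tuples_topology B) X (\<lambda>b. letter_value G b x \<otimes> word_map G w b)"
        by (intro continuous_map_mult continuous_map_letter_value) simp_all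
      then show ?case by (simp add: word_map_def)
    qed
    show "below_continuum (word_map G w ` ?K)"
      using below_continuum_subset[OF small] values_B by blast
    show "word_map G w (b \<otimes>\<^bsub>tuples B\<^esub> c)
        = word_map G w b \<otimes> word_map G w c" if "b \<in> ?K" "c \<in> ?K" for b c
      using w that by (intro word_map_mult_B) (auto)
  qed
  ultimately have "finite ((\<lambda>(u, v). u \<otimes> v) ` ((\<lambda>(b, m). ?F b m) ` (?K \<times> ?M) \<times> word_map G w ` ?K))"
    by blast
  moreover have "word_values G k w
      \<subseteq> (\<lambda>(u, v). u \<otimes> v) ` ((\<lambda>(b, m). ?F b m) ` (?K \<times> ?M) \<times> word_map G w ` ?K)"
  proof
    fix z assume "z \<in> word_values G k w"
    then obtain g where g: "g \<in> {..<k} \<rightarrow>\<^sub>E carrier G" "z = word_map G w g"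
      by (auto simp: word_values_def)
    have "\<forall>i\<in>{..<k}. \<exists>p. fst p \<in> A \<and> snd p \<in> B \<and> g i = fst p \<otimes> snd p"
    proof
      fix i assume "i \<in> {..<k}"
      then have "g i \<in> A <#> B" using g(1) G by (metis PiE_mem)
      then show "\<exists>p. fst p \<in> A \<and> snd p \<in> B \<and> g i = fst p \<otimes> snd p"
        by (auto simp: set_mult_def)
    qed
    then obtain p where p: "\<And>i. i < k \<Longrightarrow> fst (p i) \<in> A \<and> snd (p i) \<in> B \<and> g i = fst (p i) \<otimes> snd (p i)"
      by (metis lessThan_iff)
    define m where "m = (\<lambda>i\<in>{..<k}. fst (p i))"
    define b where "b = (\<lambda>i\<in>{..<k}. snd (p i))"
    have "b \<in> ?K" "m \<in> ?M" using p by (auto simp: m_def b_def)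
    moreover from this have "z = ?F b m \<otimes> word_map G w b"
      unfolding g(2) by (intro split) (use p in \<open>auto simp: m_def b_def\<close>)
    ultimately show "z \<in> (\<lambda>(u, v). u \<otimes> v) ` ((\<lambda>(b, m). ?F b m) ` (?K \<times> ?M) \<times> word_map G w ` ?K)"
      by (intro image_eqI[of _ _ "(?F b m, word_map G w b)"]) auto
  qed
  ultimately show ?thesis
    using finite_subset by blast
qed

end

theorem theorem2p8:
  fixes G :: "('a, 'm) monoid_scheme" and X :: "'a topology"
    and A B :: "'a set" and k :: nat and w :: "letter list"
  assumes "w \<in> carrier (free_group k)"
    and "profinite_group G X"
    and "A \<lhd> G" and "closedin X A" and "comm_group (G\<lparr>carrier := A\<rparr>)"
    and "subgroup B G" and "closedin X B" and "comm_group (G\<lparr>carrier := B\<rparr>)"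
    and "carrier G = A <#>\<^bsub>G\<^esub> B"
    and "word_values G k w \<prec> (UNIV :: nat set set)"
  shows "finite (word_values G k w)"
proof -
  interpret profinite_group G X by fact
  have commute: "x \<otimes>\<^bsub>G\<^esub> y = y \<otimes>\<^bsub>G\<^esub> x" if "comm_group (G\<lparr>carrier := H\<rparr>)" "x \<in> H" "y \<in> H" for H x y
    using that comm_groupE(4)[of "G\<lparr>carrier := H\<rparr>" x y] by simp
  interpret closed_abelian_factors G X A B k
    by (intro closed_abelian_factors.intro abelian_factors.intro abelian_factors_axioms.intro
        closed_abelian_factors_axioms.intro profinite_imp_compact_group assms
        commute[OF assms(5)] commute[OF assms(8)])
  show ?thesis
    using assms by (intro finite_word_values) (auto simp: free_group_def)
qed

end
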